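(* Let $\mathbb{F}=\mathbb{F}_q$ be a finite field. Then for all $m>0$: - if $\mathrm{char}\,\mathbb{F}=2$, the set $$H_{2,m}^{(2)}=\{\mathrm{tr}(Y_iY_j)\mid1\le i<j\le m\}\sqcup\{\zeta(Y_i)\mid1\le i\le m\}\sqcup\{\eta_\alpha(Y_i,Y_j)\mid1\le i<j\le m,\ \alpha\in\mathbb{F}\setminus\{0,1\}\}$$ is a minimal separating set for the algebra $\mathcal{O}(\mathcal{N}_2^m)^{\mathrm{GL}_2}$ of invariant polynomial functions on $m$-tuples of nilpotent $2\times 2$ matrices; - if $\mathrm{char}\,\mathbb{F}>2$, the set $$H_{2,m}=H_{2,m}^{(2)}\sqcup\{\mathrm{tr}(Y_iY_jY_k)\mid1\le i<j<k\le m\}$$ (with $H_{2,m}^{(2)}$ given by the formula above) is a minimal separating set for $\mathcal{O}(\mathcal{N}_2^m)^{\mathrm{GL}_2}$.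
   Context: $\mathcal{N}_2$ is the set of all nilpotent $2\times2$ matrices over $\mathbb{F}$. The group $\mathrm{GL}_2=\mathrm{GL}_2(\mathbb{F})$ acts on $\mathcal{N}_2^m$ by simultaneous conjugation: $g\cdot(A_1,\ldots,A_m)=(gA_1g^{-1},\ldots,gA_mg^{-1})$. $\mathcal{O}(\mathcal{N}_2^m)$ is the $\mathbb{F}$-algebra of functions $\mathcal{N}_2^m\to\mathbb{F}$ generated by the entry functions $y_{ij}(k):(A_1,\ldots,A_m)\mapsto(A_k)_{ij}$ ($1\le i,j\le2$, $1\le k\le m$), and $\mathcal{O}(\mathcal{N}_2^m)^{\mathrm{GL}_2}$ is the subalgebra of functions constant on $\mathrm{GL}_2$-orbits. $Y_k=(y_{ij}(k))_{1\le i,j\le2}$ is the generic nilpotent matrix, so e.g. $\mathrm{tr}(Y_iY_j)$ is the function $(A_1,\ldots,A_m)\mapsto\mathrm{tr}(A_iA_j)$. For $A,B\in\mathcal{N}_2$ and $\alpha\in\mathbb{F}^\times=\mathbb{F}\setminus\{0\}$: $\zeta(A)=1$ if $A=0$ and $\zeta(A)=0$ if $A\ne0$; $\eta_\alpha(A,B)=1$ if $\alpha A=B$ and $\eta_\alpha(A,B)=0$ if $\alpha A\ne B$. The functions $\zeta(Y_i):(A_1,\ldots,A_m)\mapsto\zeta(A_i)$ and $\eta_\alpha(Y_i,Y_j):(A_1,\ldots,A_m)\mapsto\eta_\alpha(A_i,A_j)$ for $1\le i,j\le m$ lie in $\mathcal{O}(\mathcal{N}_2^m)^{\mathrm{GL}_2}$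 (as $\mathbb{F}$ is finite). Two points are separated by a set $S$ of invariant functions if some $f\in S$ takes different values at them; $S\subset\mathcal{O}(\mathcal{N}_2^m)^{\mathrm{GL}_2}$ is separating if any two points separated by $\mathcal{O}(\mathcal{N}_2^m)^{\mathrm{GL}_2}$ are separated by $S$. A separating set is minimal if it is minimal with respect to inclusion. *)

theory Defs
  imports "HOL-Analysis.Analysis"
begin

text \<open>
  The ring operations \<open>*\<close> and \<open>^\<close> on the type \<open>'a^2^2\<close> are componentwise, so
  products and powers of matrices are written with \<open>**\<close>.
\<close>

definition nilpotent_matrix :: "'a::semiring_1^'n^'n \<Rightarrow> bool" where
  "nilpotent_matrix A \<longleftrightarrow> (\<exists>k. ((\<lambda>X. A ** X) ^^ k) (mat 1) = 0)"

definition nilp2 :: "('a::field^2^2) set" where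
  "nilp2 = {A. nilpotent_matrix A}"

text \<open>
  An \<open>m\<close>-tuple of nilpotent matrices is a function on the indices \<open>{1..m}\<close> that is
  \<open>undefined\<close> elsewhere. Likewise, a function on \<open>nilp2_tuples m\<close> is represented by
  its extension by \<open>undefined\<close> to all of \<open>nat \<Rightarrow> 'a^2^2\<close>; hence HOL equality of such
  functions is equality as functions on \<open>nilp2_tuples m\<close>.
\<close>

definition nilp2_tuples :: "nat \<Rightarrow> (nat \<Rightarrow> 'a::field^2^2) set" where
  "nilp2_tuples m = {1..m} \<rightarrow>\<^sub>E nilp2"

definition conj_tuple :: "nat \<Rightarrow> 'a::field^2^2 \<Rightarrow> (nat \<Rightarrow> 'a^2^2) \<Rightarrow> (nat \<Rightarrow> 'a^2^2)" where
  "conj_tuple m g A = (\<lambda>k\<in>{1..m}. g ** A k ** matrix_inv g)"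

inductive_set poly_functions :: "nat \<Rightarrow> ((nat \<Rightarrow> 'a::field^2^2) \<Rightarrow> 'a) set" for m :: nat where
  const: "(\<lambda>A\<in>nilp2_tuples m. c) \<in> poly_functions m"
| entry: "k \<in> {1..m} \<Longrightarrow> (\<lambda>A\<in>nilp2_tuples m. A k $ i $ j) \<in> poly_functions m"
| add: "f \<in> poly_functions m \<Longrightarrow> h \<in> poly_functions m \<Longrightarrow>
    (\<lambda>A\<in>nilp2_tuples m. f A + h A) \<in> poly_functions m"
| mult: "f \<in> poly_functions m \<Longrightarrow> h \<in> poly_functions m \<Longrightarrow>
    (\<lambda>A\<in>nilp2_tuples m. f A * h A) \<in> poly_functions m"

definition invariant_functions :: "nat \<Rightarrow> ((nat \<Rightarrow> 'a::field^2^2) \<Rightarrow> 'a) set" where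
  "invariant_functions m =
    {f \<in> poly_functions m.
      \<forall>g. invertible g \<longrightarrow> (\<forall>A \<in> nilp2_tuples m. f (conj_tuple m g A) = f A)}"

definition separates :: "('x \<Rightarrow> 'a) set \<Rightarrow> 'x \<Rightarrow> 'x \<Rightarrow> bool" where
  "separates S A B \<longleftrightarrow> (\<exists>f\<in>S. f A \<noteq> f B)"

definition separating :: "nat \<Rightarrow> ((nat \<Rightarrow> 'a::field^2^2) \<Rightarrow> 'a) set \<Rightarrow> bool" where
  "separating m S \<longleftrightarrow> S \<subseteq> invariant_functions m \<and>
    (\<forall>A \<in> nilp2_tuples m. \<forall>B \<in> nilp2_tuples m.
      separates (invariant_functions m) A B \<longrightarrow> separates S A B)"

definition minimal_separating :: "nat \<Rightarrow> ((nat \<Rightarrow> 'a::field^2^2) \<Rightarrow> 'a) set \<Rightarrow> bool" where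
  "minimal_separating m S \<longleftrightarrow> separating m S \<and> (\<forall>T. T \<subset> S \<longrightarrow> \<not> separating m T)"

definition zeta :: "'a::field^2^2 \<Rightarrow> 'a" where
  "zeta A = (if A = 0 then 1 else 0)"

definition eta :: "'a::field \<Rightarrow> 'a^2^2 \<Rightarrow> 'a^2^2 \<Rightarrow> 'a" where
  "eta \<alpha> A B = (if map_matrix ((*) \<alpha>) A = B then 1 else 0)"

definition tr2_fun :: "nat \<Rightarrow> nat \<Rightarrow> nat \<Rightarrow> (nat \<Rightarrow> 'a::field^2^2) \<Rightarrow> 'a" where
  "tr2_fun m i j = (\<lambda>A\<in>nilp2_tuples m. trace (A i ** A j))"

definition tr3_fun :: "nat \<Rightarrow> nat \<Rightarrow> nat \<Rightarrow> nat \<Rightarrow> (nat \<Rightarrow> 'a::field^2^2) \<Rightarrow> 'a" where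
  "tr3_fun m i j k = (\<lambda>A\<in>nilp2_tuples m. trace (A i ** A j ** A k))"

definition zeta_fun :: "nat \<Rightarrow> nat \<Rightarrow> (nat \<Rightarrow> 'a::field^2^2) \<Rightarrow> 'a" where
  "zeta_fun m i = (\<lambda>A\<in>nilp2_tuples m. zeta (A i))"

definition eta_fun :: "nat \<Rightarrow> 'a \<Rightarrow> nat \<Rightarrow> nat \<Rightarrow> (nat \<Rightarrow> 'a::field^2^2) \<Rightarrow> 'a" where
  "eta_fun m \<alpha> i j = (\<lambda>A\<in>nilp2_tuples m. eta \<alpha> (A i) (A j))"

text \<open>The unions below are disjoint; see \<open>H2_char2_disjoint\<close> and \<open>H2_disjoint\<close>.\<close>

definition H2_char2 :: "nat \<Rightarrow> ((nat \<Rightarrow> 'a::field^2^2) \<Rightarrow> 'a) set" where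
  "H2_char2 m =
     {tr2_fun m i j | i j. 1 \<le> i \<and> i < j \<and> j \<le> m}
   \<union> {zeta_fun m i | i. 1 \<le> i \<and> i \<le> m}
   \<union> {eta_fun m \<alpha> i j | i j \<alpha>. 1 \<le> i \<and> i < j \<and> j \<le> m \<and> \<alpha> \<in> UNIV - {0, 1}}"

definition H2 :: "nat \<Rightarrow> ((nat \<Rightarrow> 'a::field^2^2) \<Rightarrow> 'a) set" where
  "H2 m = H2_char2 m \<union> {tr3_fun m i j k | i j k. 1 \<le> i \<and> i < j \<and> j < k \<and> k \<le> m}"

lemma nilp2I: "A ** A = 0 \<Longrightarrow> A \<in> nilp2"
  unfolding nilp2_def nilpotent_matrix_def by (auto intro!: exI[of _ 2] simp: numeral_2_eq_2)

definition e12 :: "'a::field^2^2" where "e12 = (\<chi> i j. if i = 1 \<and> j = 2 then 1 else 0)"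
definition e21 :: "'a::field^2^2" where "e21 = (\<chi> i j. if i = 2 \<and> j = 1 then 1 else 0)"

lemma zero_nilp2: "0 \<in> nilp2"
  by (rule nilp2I) simp

lemma e12_nilp2: "e12 \<in> nilp2"
  by (rule nilp2I) (simp add: e12_def matrix_matrix_mult_def vec_eq_iff sum_2)

lemma e21_nilp2: "e21 \<in> nilp2"
  by (rule nilp2I) (simp add: e21_def matrix_matrix_mult_def vec_eq_iff sum_2)

lemma trace_e12_e21: "trace (e12 ** e21 :: 'a::field^2^2) = 1"
  by (simp add: e12_def e21_def matrix_matrix_mult_def trace_def sum_2)

lemma e12_nonzero: "e12 \<noteq> (0 :: 'a::field^2^2)"
  by (auto simp: e12_def vec_eq_iff)

lemma map_matrix_zero: "map_matrix ((*) \<alpha>) (0 :: 'a::field^2^2) = 0"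
  by (simp add: vec_eq_iff)

lemma map_matrix_e12: "\<alpha> \<noteq> 0 \<Longrightarrow> map_matrix ((*) \<alpha>) e12 \<noteq> (0 :: 'a::field^2^2)"
  by (auto simp: e12_def vec_eq_iff)

lemma restrict_nilp2_tuples:
  "(\<And>l. P l \<in> nilp2) \<Longrightarrow> restrict P {1..m} \<in> nilp2_tuples m"
  by (auto simp: nilp2_tuples_def)

lemmas fun_defs = tr2_fun_def tr3_fun_def zeta_fun_def eta_fun_def

lemma functions_at_zero:
  fixes m :: nat
  defines "X \<equiv> restrict (\<lambda>_. 0 :: 'a::field^2^2) {1..m}"
  assumes "i \<in> {1..m}" "j \<in> {1..m}" "k \<in> {1..m}"
  shows "tr2_fun m i j X = 0" "tr3_fun m i j k X = 0"
    "zeta_fun m i X = 1" "eta_fun m \<alpha> i j X = 1"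
  using assms restrict_nilp2_tuples[of "\<lambda>_. 0" m]
  by (auto simp: fun_defs zeta_def eta_def map_matrix_zero zero_nilp2 trace_0 trace_def)

lemma zeta_fun_neq_eta_fun:
  assumes "i \<in> {1..m}" "1 \<le> j" "j < k" "k \<le> m" "\<alpha> \<noteq> (0::'a::field)"
  shows "zeta_fun m i \<noteq> eta_fun m \<alpha> j k"
proof
  assume eq: "zeta_fun m i = eta_fun m \<alpha> j k"
  define l where "l = (if i = j then k else j)"
  define A where "A = restrict (\<lambda>n. if n = l then e12 else 0 :: 'a^2^2) {1..m}"
  have A: "A \<in> nilp2_tuples m"
    unfolding A_def by (rule restrict_nilp2_tuples) (simp add: zero_nilp2 e12_nilp2)
  have "zeta_fun m i A = 1"
    using A assms by (simp add: fun_defs zeta_def) (simp add: A_def l_def)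
  moreover have "eta_fun m \<alpha> j k A = 0"
    using A assms e12_nonzero[where 'a='a] map_matrix_e12[of \<alpha>]
    by (simp add: fun_defs eta_def) (auto simp: A_def l_def map_matrix_zero)
  ultimately show False using eq by simp
qed

lemma tr3_fun_neq_tr2_fun:
  assumes "1 \<le> i" "i < j" "j < k" "k \<le> m" "1 \<le> a" "a < b" "b \<le> m"
  shows "tr3_fun m i j k \<noteq> (tr2_fun m a b :: (nat \<Rightarrow> 'a::field^2^2) \<Rightarrow> 'a)"
proof
  assume eq: "tr3_fun m i j k = (tr2_fun m a b :: (nat \<Rightarrow> 'a^2^2) \<Rightarrow> 'a)"
  define A where
    "A = restrict (\<lambda>n. if n = a then e12 else if n = b then e21 else 0 :: 'a^2^2) {1..m}"
  have A: "A \<in> nilp2_tuples m"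
    unfolding A_def by (rule restrict_nilp2_tuples) (simp add: zero_nilp2 e12_nilp2 e21_nilp2)
  have "A i = 0 \<or> A j = 0 \<or> A k = 0"
    using assms by (auto simp: A_def)
  then have "tr3_fun m i j k A = 0"
    using A by (auto simp: fun_defs trace_def)
  moreover have "tr2_fun m a b A = 1"
    using A assms by (simp add: fun_defs) (simp add: A_def trace_e12_e21)
  ultimately show False using eq by simp
qed

lemma H2_char2_disjoint:
  fixes m :: nat
  defines "TR \<equiv> {tr2_fun m i j | i j. 1 \<le> i \<and> i < j \<and> j \<le> m}
      :: ((nat \<Rightarrow> 'a::field^2^2) \<Rightarrow> 'a) set"
    and "Z \<equiv> {zeta_fun m i | i. 1 \<le> i \<and> i \<le> m}"
    and "E \<equiv> {eta_fun m \<alpha> i j | i j \<alpha>. 1 \<le> i \<and> i < j \<and> j \<le> m \<and> \<alpha> \<in> UNIV - {0, 1}}"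
  shows "TR \<inter> Z = {}" "TR \<inter> E = {}" "Z \<inter> E = {}"
proof -
  define X where "X = restrict (\<lambda>_. 0 :: 'a^2^2) {1..m}"
  have t: "tr2_fun m i j X = 0" if "1 \<le> i" "i < j" "j \<le> m" for i j
    using that functions_at_zero(1)[of i m j i] by (simp add: X_def)
  have z: "zeta_fun m i X = 1" if "1 \<le> i" "i \<le> m" for i
    using that functions_at_zero(3)[of i m i i] by (simp add: X_def)
  have e: "eta_fun m \<alpha> i j X = 1" if "1 \<le> i" "i < j" "j \<le> m" for \<alpha> i j
    using that functions_at_zero(4)[of i m j i] by (simp add: X_def)
  have "f X = 0" if "f \<in> TR" for f using that t unfolding TR_def by auto
  moreover have "f X = 1" if "f \<in> Z" for f using that z unfolding Z_def by auto
  moreover have "f X = 1" if "f \<in> E" for f using that e unfolding E_def by auto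
  ultimately show "TR \<inter> Z = {}" "TR \<inter> E = {}"
    by (metis disjoint_iff zero_neq_one)+
  have "f \<noteq> g" if f: "f \<in> Z" and g: "g \<in> E" for f g
  proof -
    obtain i where i: "f = zeta_fun m i" "1 \<le> i" "i \<le> m"
      using f unfolding Z_def by auto
    obtain j k \<alpha> where "g = eta_fun m \<alpha> j k" "1 \<le> j" "j < k" "k \<le> m" "\<alpha> \<noteq> 0"
      using g unfolding E_def by auto
    then show ?thesis using i zeta_fun_neq_eta_fun[of i m j k \<alpha>] by simp
  qed
  then show "Z \<inter> E = {}" by blast
qed

lemma H2_disjoint:
  "(H2_char2 m :: ((nat \<Rightarrow> 'a::field^2^2) \<Rightarrow> 'a) set) \<inter>
    {tr3_fun m i j k | i j k. 1 \<le> i \<and> i < j \<and> j < k \<and> k \<le> m} = {}"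
proof -
  define X where "X = restrict (\<lambda>_. 0 :: 'a^2^2) {1..m}"
  have t: "tr3_fun m i j k X = 0" if "1 \<le> i" "i < j" "j < k" "k \<le> m" for i j k
    using that functions_at_zero(2)[of i m j k] by (simp add: X_def)
  have z: "zeta_fun m i X = 1" if "1 \<le> i" "i \<le> m" for i
    using that functions_at_zero(3)[of i m i i] by (simp add: X_def)
  have e: "eta_fun m \<alpha> i j X = 1" if "1 \<le> i" "i < j" "j \<le> m" for \<alpha> i j
    using that functions_at_zero(4)[of i m j i] by (simp add: X_def)
  have "h \<noteq> tr3_fun m i j k"
    if ijk: "1 \<le> i" "i < j" "j < k" "k \<le> m" and "h \<in> H2_char2 m"
    for i j k and h :: "(nat \<Rightarrow> 'a^2^2) \<Rightarrow> 'a"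
    using that(5) unfolding H2_char2_def
  proof (elim UnE)
    assume "h \<in> {tr2_fun m i j | i j. 1 \<le> i \<and> i < j \<and> j \<le> m}"
    then obtain a b where "h = tr2_fun m a b" "1 \<le> a" "a < b" "b \<le> m" by auto
    then show ?thesis using tr3_fun_neq_tr2_fun[OF ijk, of a b, where 'a='a] by metis
  next
    assume "h \<in> {zeta_fun m i | i. 1 \<le> i \<and> i \<le> m}"
    then have "h X = 1" using z by auto
    then show ?thesis using t[OF ijk] by auto
  next
    assume "h \<in> {eta_fun m \<alpha> i j | i j \<alpha>. 1 \<le> i \<and> i < j \<and> j \<le> m \<and> \<alpha> \<in> UNIV - {0, 1}}"
    then have "h X = 1" using e by auto
    then show ?thesis using t[OF ijk] by auto
  qed
  then show ?thesis by blast
qed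

end

theory Submission
  imports Defs
begin

text \<open>
  Over a finite field every function on tuples is polynomial, so invariants separate exactly the
  orbits. If all \<open>tr(A\<^sub>iA\<^sub>j)\<close> vanish, the entries of a tuple are multiples of a single nilpotent
  matrix and \<open>\<zeta>\<close>, \<open>\<eta>\<^sub>\<alpha>\<close> recover the multiples up to a common factor (the ratio \<open>1\<close> being the only
  one left). If \<open>t = tr(A\<^sub>iA\<^sub>j) \<noteq> 0\<close>, one may conjugate to \<open>A\<^sub>i = E\<^sub>1\<^sub>2\<close> and \<open>A\<^sub>j = t E\<^sub>2\<^sub>1\<close>; then
  \<open>tr(A\<^sub>iA\<^sub>k)\<close> and \<open>tr(A\<^sub>jA\<^sub>k)\<close> give the off-diagonal entries of \<open>A\<^sub>k\<close>, and its diagonal entry \<open>a\<close> is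
  determined by \<open>a\<^sup>2 = -bc\<close> in characteristic 2 and by \<open>tr(A\<^sub>iA\<^sub>jA\<^sub>k) = t a\<close> otherwise.
  Minimality is witnessed by explicit pairs of tuples with at most three distinct nonzero entries.
\<close>

section \<open>Nilpotent two-by-two matrices\<close>

lemma mat2_eq_iff:
  "(A :: 'a^2^2) = B \<longleftrightarrow>
    A $ 1 $ 1 = B $ 1 $ 1 \<and> A $ 1 $ 2 = B $ 1 $ 2 \<and> A $ 2 $ 1 = B $ 2 $ 1 \<and> A $ 2 $ 2 = B $ 2 $ 2"
  by (auto simp: vec_eq_iff forall_2)

lemma mat2_mult_nth:
  "((A :: 'a::semiring_1^2^2) ** B) $ i $ j = A $ i $ 1 * B $ 1 $ j + A $ i $ 2 * B $ 2 $ j"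
  by (simp add: matrix_matrix_mult_def sum_2)

lemma trace_2: "trace (A :: 'a::semiring_1^2^2) = A $ 1 $ 1 + A $ 2 $ 2"
  by (simp add: trace_def sum_2)

lemma e12_nth [simp]:
  "e12 $ 1 $ 1 = 0" "e12 $ 1 $ 2 = 1" "e12 $ 2 $ 1 = 0" "e12 $ 2 $ 2 = 0"
  by (simp_all add: e12_def)

lemma e21_nth [simp]:
  "e21 $ 1 $ 1 = 0" "e21 $ 1 $ 2 = 0" "e21 $ 2 $ 1 = 1" "e21 $ 2 $ 2 = 0"
  by (simp_all add: e21_def)

text \<open>These conditions are trace 0 and determinant 0. The off-diagonal entries of the square
  are \<open>b * (a + d)\<close> and \<open>c * (a + d)\<close>, so a nonzero trace would force
  \<open>b = c = 0\<close>, and then the diagonal entries, whose squares vanish, would be 0 as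
  well.\<close>

lemma square_zero_mat2_iff:
  fixes A :: "'a::field^2^2"
  shows "A ** A = 0 \<longleftrightarrow> A $ 2 $ 2 = - A $ 1 $ 1 \<and> A $ 1 $ 1 * A $ 1 $ 1 + A $ 1 $ 2 * A $ 2 $ 1 = 0"
proof
  assume A: "A ** A = 0"
  define a b c d where "a = A $ 1 $ 1" "b = A $ 1 $ 2" "c = A $ 2 $ 1" "d = A $ 2 $ 2"
  note defs = this
  have eqs: "a * a + b * c = 0" "b * (a + d) = 0" "c * (a + d) = 0" "d * d + b * c = 0"
    using A by (auto simp: mat2_eq_iff mat2_mult_nth defs algebra_simps)
  have "a + d = 0"
  proof (rule ccontr)
    assume "a + d \<noteq> 0"
    with eqs have "b = 0" "c = 0" by auto
    with eqs have "a = 0" "d = 0" by auto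
    with \<open>a + d \<noteq> 0\<close> show False by simp
  qed
  with eqs show "A $ 2 $ 2 = - A $ 1 $ 1 \<and> A $ 1 $ 1 * A $ 1 $ 1 + A $ 1 $ 2 * A $ 2 $ 1 = 0"
    by (simp add: defs eq_neg_iff_add_eq_0 add.commute)
next
  assume "A $ 2 $ 2 = - A $ 1 $ 1 \<and> A $ 1 $ 1 * A $ 1 $ 1 + A $ 1 $ 2 * A $ 2 $ 1 = 0"
  then show "A ** A = 0"
    by (simp add: mat2_eq_iff mat2_mult_nth algebra_simps)
qed

text \<open>Multiplicativity of \<open>det\<close> gives determinant 0. Cayley-Hamilton then turns
  the square into \<open>t\<close> times \<open>A\<close>, with \<open>t\<close> the trace, so the
  power with exponent \<open>n + 1\<close> is \<open>t ^ n\<close> times \<open>A\<close>.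
  Nilpotence therefore forces \<open>t = 0\<close> or \<open>A = 0\<close>.\<close>

lemma nilp2_iff_square_zero: "A \<in> nilp2 \<longleftrightarrow> A ** A = 0"
proof
  let ?pow = "\<lambda>k. ((\<lambda>X. A ** X) ^^ k) (mat 1)"
  assume "A \<in> nilp2"
  then obtain k where k: "?pow k = 0"
    by (auto simp: nilp2_def nilpotent_matrix_def)
  have "det (?pow n) = det A ^ n" for n
    by (induction n) (simp_all add: det_mul)
  from this[of k] have det: "A $ 1 $ 1 * A $ 2 $ 2 = A $ 1 $ 2 * A $ 2 $ 1"
    by (simp add: k det_2)
  define t where "t = A $ 1 $ 1 + A $ 2 $ 2"
  have sq: "(A ** A) $ i $ j = t * A $ i $ j" for i j
    using det exhaust_2[of i] exhaust_2[of j]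
    by (auto simp: mat2_mult_nth t_def algebra_simps)
  have pow: "?pow (Suc n) $ i $ j = t ^ n * A $ i $ j" for n i j
  proof (induction n arbitrary: i j)
    case (Suc n)
    have "?pow (Suc (Suc n)) $ i $ j = A $ i $ 1 * ?pow (Suc n) $ 1 $ j + A $ i $ 2 * ?pow (Suc n) $ 2 $ j"
      by (simp add: mat2_mult_nth)
    also have "\<dots> = t ^ n * (A ** A) $ i $ j"
      unfolding Suc by (simp add: mat2_mult_nth algebra_simps)
    finally show ?case by (simp add: sq)
  qed simp
  have "?pow (Suc k) = 0" using k by simp
  then have "t ^ k * A $ i $ j = 0" for i j by (metis pow zero_index)
  then have "t * A $ i $ j = 0" for i j by (metis mult_eq_0_iff power_eq_0_iff)
  then show "A ** A = 0" by (simp add: vec_eq_iff sq)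
qed (rule nilp2I)

lemma nilp2_iff:
  "A \<in> nilp2 \<longleftrightarrow> A $ 2 $ 2 = - A $ 1 $ 1 \<and> A $ 1 $ 1 * A $ 1 $ 1 + A $ 1 $ 2 * A $ 2 $ 1 = 0"
  by (simp add: nilp2_iff_square_zero square_zero_mat2_iff)

lemma map_matrix_nilp2: "A \<in> nilp2 \<Longrightarrow> map_matrix ((*) c) A \<in> nilp2"
  by (simp add: nilp2_iff algebra_simps) (metis distrib_left mult_zero_right)

section \<open>Conjugation\<close>

definition conj_mat :: "'a::field^'n^'n \<Rightarrow> 'a^'n^'n \<Rightarrow> 'a^'n^'n" where
  "conj_mat g A = g ** A ** matrix_inv g"

lemma matrix_inv_cancel:
  assumes "invertible A"
  shows "A ** matrix_inv A = mat 1" "matrix_inv A ** A = mat 1"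
  using someI_ex[OF assms[unfolded invertible_def]] unfolding matrix_inv_def by auto

lemma conj_mat_mult:
  assumes "invertible g"
  shows "conj_mat g A ** conj_mat g B = conj_mat g (A ** B)"
proof -
  have "conj_mat g A ** conj_mat g B = g ** A ** (matrix_inv g ** g) ** B ** matrix_inv g"
    by (simp only: conj_mat_def matrix_mul_assoc)
  then show ?thesis by (simp add: matrix_inv_cancel[OF assms] conj_mat_def matrix_mul_assoc)
qed

lemma trace_conj_mat: "invertible g \<Longrightarrow> trace (conj_mat g A) = trace A"
  unfolding conj_mat_def
  by (subst trace_mul_sym) (simp add: matrix_mul_assoc matrix_inv_cancel)

text \<open>Clears the inverse, so that a conjugation can be checked on entries.\<close>

lemma conj_mat_eq_iff: "invertible g \<Longrightarrow> conj_mat g A = B \<longleftrightarrow> g ** A = B ** g"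
  unfolding conj_mat_def
  by (metis matrix_inv_cancel matrix_mul_assoc matrix_mul_rid)

lemma conj_mat_inject: "invertible g \<Longrightarrow> conj_mat g A = conj_mat g B \<longleftrightarrow> A = B"
  by (metis conj_mat_eq_iff matrix_inv_cancel matrix_mul_assoc matrix_mul_lid)

lemma conj_mat_zero: "conj_mat g 0 = 0"
  by (simp add: conj_mat_def)

lemma conj_mat_map_matrix:
  "conj_mat g (map_matrix ((*) c) A) = map_matrix ((*) c) (conj_mat g A)"
  by (simp add: conj_mat_def vec_eq_iff matrix_matrix_mult_def sum_distrib_left sum_distrib_right
      mult.assoc mult.left_commute)

lemma conj_mat_nilp2: "invertible g \<Longrightarrow> A \<in> nilp2 \<Longrightarrow> conj_mat g A \<in> nilp2"
  by (simp add: nilp2_iff_square_zero conj_mat_mult conj_mat_zero)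

lemma conj_tuple_eq: "conj_tuple m g A = (\<lambda>k\<in>{1..m}. conj_mat g (A k))"
  by (simp add: conj_tuple_def conj_mat_def)

lemma conj_tuple_nth: "k \<in> {1..m} \<Longrightarrow> conj_tuple m g A k = conj_mat g (A k)"
  by (simp add: conj_tuple_eq)

lemma nilp2_tuples_nth: "A \<in> nilp2_tuples m \<Longrightarrow> k \<in> {1..m} \<Longrightarrow> A k \<in> nilp2"
  by (auto simp: nilp2_tuples_def)

lemma nilp2_tuples_eqI:
  "A \<in> nilp2_tuples m \<Longrightarrow> B \<in> nilp2_tuples m \<Longrightarrow> (\<And>k. k \<in> {1..m} \<Longrightarrow> A k = B k) \<Longrightarrow> A = B"
  unfolding nilp2_tuples_def by (rule PiE_ext)

lemma conj_tuple_nilp2_tuples: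
  "invertible g \<Longrightarrow> A \<in> nilp2_tuples m \<Longrightarrow> conj_tuple m g A \<in> nilp2_tuples m"
  unfolding conj_tuple_eq
  by (subst nilp2_tuples_def) (intro restrict_PiE_iff[THEN iffD2] ballI conj_mat_nilp2 nilp2_tuples_nth)

lemma exists_conj_e12:
  fixes N :: "'a::field^2^2"
  assumes N: "N \<in> nilp2" "N \<noteq> 0"
  shows "\<exists>g. invertible g \<and> conj_mat g N = e12"
proof -
  define a b c where "a = N $ 1 $ 1" "b = N $ 1 $ 2" "c = N $ 2 $ 1"
  note defs = this
  have ent: "N $ 2 $ 2 = - a" "b * c = - (a * a)"
    using N by (auto simp: nilp2_iff defs eq_neg_iff_add_eq_0 add.commute)
  \<comment> \<open>The equation \<open>g ** N = e12 ** g\<close> says that the first row of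
    \<open>g\<close> times \<open>N\<close> is the second row, and that the second row times
    \<open>N\<close> is 0. The latter follows from the former because \<open>N\<close> squares to 0.
    So the first row is a basis row that \<open>N\<close> does not annihilate, and the second row is
    its image.\<close>
  define g :: "'a^2^2" where
    "g = (if c \<noteq> 0 then vector [vector [0, 1], vector [c, - a]] else vector [vector [1, 0], vector [0, b]])"
  have "b \<noteq> 0" "a = 0" if "c = 0"
    using that N ent by (auto simp: mat2_eq_iff defs)
  then have "invertible g" "g ** N = e12 ** g"
    using ent by (auto simp: g_def invertible_det_nz det_2 mat2_eq_iff mat2_mult_nth algebra_simps
        simp flip: defs)
  then show ?thesis by (auto simp: conj_mat_eq_iff)
qed

text \<open>After \<open>M\<close> is moved to \<open>e12\<close>, the trace is the lower left entry
  of the conjugated \<open>N\<close>. A unipotent upper triangular matrix commutes with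
  \<open>e12\<close>, and as this entry is nonzero it can be chosen to clear the diagonal;
  nilpotence then makes the upper right entry vanish too.\<close>

lemma exists_conj_e12_e21:
  fixes M N :: "'a::field^2^2"
  assumes M: "M \<in> nilp2" and N: "N \<in> nilp2" and t: "trace (M ** N) \<noteq> 0"
  shows "\<exists>g. invertible g \<and> conj_mat g M = e12 \<and> conj_mat g N = map_matrix ((*) (trace (M ** N))) e21"
proof -
  have "M \<noteq> 0" using t by (auto simp: trace_def)
  then obtain g where g: "invertible g" "conj_mat g M = e12"
    using exists_conj_e12 M by blast
  define P where "P = conj_mat g N"
  have P: "P \<in> nilp2" using g N by (simp add: P_def conj_mat_nilp2)
  have "trace (M ** N) = trace (e12 ** P)"
    using g by (metis P_def conj_mat_mult trace_conj_mat)
  then have c: "trace (M ** N) = P $ 2 $ 1" by (simp add: trace_2 mat2_mult_nth)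
  define h :: "'a^2^2" where "h = vector [vector [1, - P $ 1 $ 1 / P $ 2 $ 1], vector [0, 1]]"
  have h: "invertible h" by (simp add: h_def invertible_det_nz det_2)
  have he: "h ** e12 = e12 ** h"
    by (simp add: h_def mat2_eq_iff mat2_mult_nth)
  have "h ** P = map_matrix ((*) (P $ 2 $ 1)) e21 ** h"
    using P t by (auto simp: h_def mat2_eq_iff mat2_mult_nth nilp2_iff c field_simps)
  then have hP: "conj_mat h P = map_matrix ((*) (P $ 2 $ 1)) e21"
    using h by (simp add: conj_mat_eq_iff)
  have comp: "conj_mat (h ** g) X = conj_mat h (conj_mat g X)" for X
  proof -
    have "conj_mat h (conj_mat g X) ** (h ** g) = h ** (conj_mat g X ** g)"
      using h by (metis conj_mat_eq_iff matrix_mul_assoc)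
    also have "\<dots> = h ** g ** X"
      using g by (metis conj_mat_eq_iff matrix_mul_assoc)
    finally show ?thesis using h g by (simp add: conj_mat_eq_iff invertible_mult)
  qed
  show ?thesis
    using g h he hP c by (intro exI[of _ "h ** g"])
      (simp add: comp invertible_mult conj_mat_eq_iff[of h e12] flip: P_def)
qed

section \<open>Invariant functions over a finite field\<close>

text \<open>Polynomial functions are \<open>undefined\<close> off the tuples, so agreement on tuples
  identifies them. This removes the nested restrictions that \<open>add\<close> and
  \<open>mult\<close> produce.\<close>

lemma poly_functions_cong:
  assumes "h \<in> poly_functions m" "\<And>A. A \<in> nilp2_tuples m \<Longrightarrow> f A = h A"
  shows "restrict f (nilp2_tuples m) \<in> poly_functions m"
proof -
  have "h \<in> extensional (nilp2_tuples m)"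
    using assms(1) by induction (simp_all only: restrict_extensional)
  then have "restrict f (nilp2_tuples m) = h"
    using assms(2) by (auto simp: fun_eq_iff extensional_def)
  then show ?thesis using assms(1) by simp
qed

lemma poly_functions_plus:
  assumes "restrict f (nilp2_tuples m) \<in> poly_functions m" "restrict h (nilp2_tuples m) \<in> poly_functions m"
  shows "(\<lambda>A\<in>nilp2_tuples m. f A + h A) \<in> poly_functions m"
  by (rule poly_functions_cong[OF poly_functions.add[OF assms]]) simp

lemma poly_functions_times:
  assumes "restrict f (nilp2_tuples m) \<in> poly_functions m" "restrict h (nilp2_tuples m) \<in> poly_functions m"
  shows "(\<lambda>A\<in>nilp2_tuples m. f A * h A) \<in> poly_functions m"
  by (rule poly_functions_cong[OF poly_functions.mult[OF assms]]) simp

lemma poly_functions_sum: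
  assumes "\<And>i. i \<in> I \<Longrightarrow> restrict (f i) (nilp2_tuples m) \<in> poly_functions m"
  shows "(\<lambda>A\<in>nilp2_tuples m. \<Sum>i\<in>I. f i A :: 'a::field) \<in> poly_functions m"
  using assms
proof (induction I rule: infinite_finite_induct)
  case (insert x F)
  have "(\<lambda>A\<in>nilp2_tuples m. f x A + (\<Sum>i\<in>F. f i A)) \<in> poly_functions m"
    by (intro poly_functions_plus insert.IH insert.prems) simp_all
  then show ?case by (simp only: sum.insert[OF insert.hyps])
qed (use poly_functions.const[of "0 :: 'a" m] in \<open>simp_all only: not_False_eq_True sum.infinite sum.empty\<close>)

lemma poly_functions_prod:
  assumes "\<And>i. i \<in> I \<Longrightarrow> restrict (f i) (nilp2_tuples m) \<in> poly_functions m"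
  shows "(\<lambda>A\<in>nilp2_tuples m. \<Prod>i\<in>I. f i A :: 'a::field) \<in> poly_functions m"
  using assms
proof (induction I rule: infinite_finite_induct)
  case (insert x F)
  have "(\<lambda>A\<in>nilp2_tuples m. f x A * (\<Prod>i\<in>F. f i A)) \<in> poly_functions m"
    by (intro poly_functions_times insert.IH insert.prems) simp_all
  then show ?case by (simp only: prod.insert[OF insert.hyps])
qed (use poly_functions.const[of "1 :: 'a" m] in \<open>simp_all only: not_False_eq_True prod.infinite prod.empty\<close>)

text \<open>Lagrange interpolation over the finite field: the product of
  \<open>(x - c) / (a - c)\<close> over all \<open>c \<noteq> a\<close> is 1 at \<open>x = a\<close>
  and 0 elsewhere.\<close>

lemma poly_functions_entry_indicator:
  fixes a :: "'a::{field, finite}"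
  assumes "k \<in> {1..m}"
  shows "(\<lambda>A\<in>nilp2_tuples m. of_bool (A k $ i $ j = a)) \<in> poly_functions m"
proof -
  \<comment> \<open>The linear factor is written with sums and products of an entry and constants
    only, so that the closure rules apply.\<close>
  define f where "f c A = A k $ i $ j * inverse (a - c) + - c * inverse (a - c)"
    for c :: 'a and A :: "nat \<Rightarrow> 'a^2^2"
  have "restrict (f c) (nilp2_tuples m) \<in> poly_functions m" for c
    unfolding f_def using assms
    by (intro poly_functions_plus poly_functions_times poly_functions.const poly_functions.entry)
  then have *: "(\<lambda>A\<in>nilp2_tuples m. \<Prod>c\<in>UNIV - {a}. f c A) \<in> poly_functions m"
    by (rule poly_functions_prod)
  have f: "f c A = (A k $ i $ j - c) / (a - c)" for c A
    by (simp add: f_def field_class.field_divide_inverse algebra_simps)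
  have "(\<Prod>c\<in>UNIV - {a}. f c A) = of_bool (A k $ i $ j = a)" for A
    by (auto simp: f prod_zero_iff intro!: prod.neutral)
  with * show ?thesis by simp
qed

lemma restrict_poly_functions:
  fixes f :: "(nat \<Rightarrow> 'a::{field, finite}^2^2) \<Rightarrow> 'a"
  shows "restrict f (nilp2_tuples m) \<in> poly_functions m"
proof -
  \<comment> \<open>\<open>d B\<close> is the indicator of the single tuple \<open>B\<close>; every
    function is a combination of these finitely many indicators.\<close>
  define d :: "_ \<Rightarrow> _ \<Rightarrow> 'a" where "d B A = (\<Prod>k\<in>{1..m}. \<Prod>i\<in>UNIV. \<Prod>j\<in>UNIV. of_bool (A k $ i $ j = B k $ i $ j))"
    for A B :: "nat \<Rightarrow> 'a^2^2"
  have d_poly: "restrict (d B) (nilp2_tuples m) \<in> poly_functions m" for B :: "nat \<Rightarrow> 'a^2^2"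
    unfolding d_def by (intro poly_functions_prod poly_functions_entry_indicator)
  have d: "d B A = of_bool (A = B)" if "A \<in> nilp2_tuples m" "B \<in> nilp2_tuples m"
    for A B :: "nat \<Rightarrow> 'a^2^2"
  proof (cases "A = B")
    case False
    with nilp2_tuples_eqI[OF that] obtain k where "k \<in> {1..m}" "A k \<noteq> B k" by blast
    then show ?thesis using False by (auto simp: d_def prod_zero_iff vec_eq_iff)
  qed (simp add: d_def)
  have fin: "finite (nilp2_tuples m :: (nat \<Rightarrow> 'a^2^2) set)"
    unfolding nilp2_tuples_def by (intro finite_PiE) auto
  have "(\<lambda>A\<in>nilp2_tuples m. \<Sum>B\<in>nilp2_tuples m. f B * d B A) \<in> poly_functions m"
    by (intro poly_functions_sum poly_functions_times d_poly poly_functions.const)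
  then show ?thesis
    by (rule poly_functions_cong) (simp add: d fin)
qed

text \<open>Polynomiality is automatic over a finite field, which leaves only invariance to
  check.\<close>

lemma restrict_invariant_functions:
  fixes f :: "(nat \<Rightarrow> 'a::{field, finite}^2^2) \<Rightarrow> 'a"
  assumes "\<And>g A. invertible g \<Longrightarrow> A \<in> nilp2_tuples m \<Longrightarrow> f (conj_tuple m g A) = f A"
  shows "restrict f (nilp2_tuples m) \<in> invariant_functions m"
  using assms restrict_poly_functions[of f m]
  by (auto simp: invariant_functions_def conj_tuple_nilp2_tuples)

lemma H2_char2_subset_H2: "H2_char2 m \<subseteq> H2 m"
  by (simp add: H2_def)

lemma H2_subset_invariant_functions:
  "(H2 m :: ((nat \<Rightarrow> 'a::{field, finite}^2^2) \<Rightarrow> 'a) set) \<subseteq> invariant_functions m"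
proof -
  have zero: "conj_mat g A = 0 \<longleftrightarrow> A = 0" if "invertible g" for g A :: "'a^2^2"
    using conj_mat_inject[OF that, of A 0] by (simp add: conj_mat_zero)
  have "tr2_fun m i j \<in> (invariant_functions m :: ((nat \<Rightarrow> 'a^2^2) \<Rightarrow> 'a) set)"
    if "i \<in> {1..m}" "j \<in> {1..m}" for i j
    unfolding tr2_fun_def using that
    by (intro restrict_invariant_functions) (simp add: conj_tuple_nth conj_mat_mult trace_conj_mat)
  moreover have "tr3_fun m i j k \<in> (invariant_functions m :: ((nat \<Rightarrow> 'a^2^2) \<Rightarrow> 'a) set)"
    if "i \<in> {1..m}" "j \<in> {1..m}" "k \<in> {1..m}" for i j k
    unfolding tr3_fun_def using that
    by (intro restrict_invariant_functions) (simp add: conj_tuple_nth conj_mat_mult trace_conj_mat)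
  moreover have "zeta_fun m i \<in> (invariant_functions m :: ((nat \<Rightarrow> 'a^2^2) \<Rightarrow> 'a) set)"
    if "i \<in> {1..m}" for i
    unfolding zeta_fun_def using that
    by (intro restrict_invariant_functions) (simp add: conj_tuple_nth zeta_def zero)
  moreover have "eta_fun m \<alpha> i j \<in> (invariant_functions m :: ((nat \<Rightarrow> 'a^2^2) \<Rightarrow> 'a) set)"
    if "i \<in> {1..m}" "j \<in> {1..m}" for i j \<alpha>
    unfolding eta_fun_def using that
    by (intro restrict_invariant_functions)
      (simp add: conj_tuple_nth eta_def conj_mat_inject flip: conj_mat_map_matrix)
  ultimately show ?thesis by (auto simp: H2_def H2_char2_def)
qed

lemma invariant_conj_tuple:
  "f \<in> invariant_functions m \<Longrightarrow> invertible g \<Longrightarrow> A \<in> nilp2_tuples m \<Longrightarrow> f (conj_tuple m g A) = f A"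
  by (simp add: invariant_functions_def)

section \<open>Separation\<close>

lemma H2_char2_agreeD:
  assumes "\<forall>f \<in> H2_char2 m. f A = f B" "A \<in> nilp2_tuples m" "B \<in> nilp2_tuples m"
  shows "i \<in> {1..m} \<Longrightarrow> A i = 0 \<longleftrightarrow> B i = 0"
    and "i \<in> {1..m} \<Longrightarrow> j \<in> {1..m} \<Longrightarrow> i < j \<Longrightarrow> \<alpha> \<noteq> 0 \<Longrightarrow> \<alpha> \<noteq> 1 \<Longrightarrow>
      map_matrix ((*) \<alpha>) (A i) = A j \<longleftrightarrow> map_matrix ((*) \<alpha>) (B i) = B j"
    and "i \<in> {1..m} \<Longrightarrow> j \<in> {1..m} \<Longrightarrow> trace (A i ** A j) = trace (B i ** B j)"
proof -
  show "A i = 0 \<longleftrightarrow> B i = 0" if "i \<in> {1..m}"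
  proof -
    have "zeta_fun m i \<in> H2_char2 m" using that by (auto simp: H2_char2_def)
    then have "zeta_fun m i A = zeta_fun m i B" using assms(1) by blast
    then show ?thesis using assms by (simp add: zeta_fun_def zeta_def split: if_splits)
  qed
  show "map_matrix ((*) \<alpha>) (A i) = A j \<longleftrightarrow> map_matrix ((*) \<alpha>) (B i) = B j"
    if "i \<in> {1..m}" "j \<in> {1..m}" "i < j" "\<alpha> \<noteq> 0" "\<alpha> \<noteq> 1"
  proof -
    have "eta_fun m \<alpha> i j \<in> H2_char2 m"
      using that unfolding H2_char2_def atLeastAtMost_iff by blast
    then have "eta_fun m \<alpha> i j A = eta_fun m \<alpha> i j B" using assms(1) by blast
    then show ?thesis using assms by (simp add: eta_fun_def eta_def split: if_splits)
  qed
  have tr: "trace (A i ** A j) = trace (B i ** B j)"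
    if "i \<in> {1..m}" "j \<in> {1..m}" "i < j" for i j
  proof -
    have "tr2_fun m i j \<in> H2_char2 m" using that by (auto simp: H2_char2_def)
    then have "tr2_fun m i j A = tr2_fun m i j B" using assms(1) by blast
    then show ?thesis using assms by (simp add: tr2_fun_def)
  qed
  show "trace (A i ** A j) = trace (B i ** B j)" if ij: "i \<in> {1..m}" "j \<in> {1..m}"
  proof -
    \<comment> \<open>The generators cover only \<open>i < j\<close>. The reverse order follows from
      the symmetry of the trace, and on the diagonal both squares are 0.\<close>
    consider "i < j" | "j < i" | "i = j" by linarith
    then show ?thesis
    proof cases
      case 1 then show ?thesis using tr ij by blast
    next
      case 2 then show ?thesis using tr[of j i] ij by (metis trace_mul_sym)
    next
      case 3
      then show ?thesis
        using ij assms by (metis nilp2_iff_square_zero nilp2_tuples_nth)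
    qed
  qed
qed

lemma H2_agreeD:
  assumes "\<forall>f \<in> H2 m. f A = f B" "A \<in> nilp2_tuples m" "B \<in> nilp2_tuples m"
    "i \<in> {1..m}" "j \<in> {1..m}" "k \<in> {1..m}" "i < j" "j < k"
  shows "trace (A i ** A j ** A k) = trace (B i ** B j ** B k)"
proof -
  have "tr3_fun m i j k \<in> H2 m" using assms by (auto simp: H2_def)
  then have "tr3_fun m i j k A = tr3_fun m i j k B" using assms(1) by blast
  then show ?thesis using assms by (simp add: tr3_fun_def)
qed

text \<open>The trace of \<open>e12 ** X\<close> is the lower left entry of \<open>X\<close>. If it
  is 0, a nilpotent \<open>X\<close> has zero diagonal and is a multiple of \<open>e12\<close>.
  Comparison with the entry at \<open>i\<close>, which is \<open>e12\<close> itself, determines the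
  multiple.\<close>

lemma multiples_of_e12_eq:
  fixes A B :: "nat \<Rightarrow> 'a::field^2^2"
  assumes agree: "\<forall>f \<in> H2_char2 m. f A = f B"
    and A: "A \<in> nilp2_tuples m" and B: "B \<in> nilp2_tuples m"
    and i: "i \<in> {1..m}" "A i = e12" "B i = e12"
    and tr: "\<forall>j\<in>{1..m}. trace (A i ** A j) = 0"
  shows "A = B"
proof (rule nilp2_tuples_eqI[OF A B])
  note D = H2_char2_agreeD[OF agree A B]
  fix k assume k: "k \<in> {1..m}"
  have e12_multiple: "X = map_matrix ((*) (X $ 1 $ 2)) e12" if "X \<in> nilp2" "trace (e12 ** X) = 0" for X :: "'a^2^2"
    using that by (auto simp: nilp2_iff mat2_eq_iff trace_2 mat2_mult_nth)
  define a b where "a = A k $ 1 $ 2" "b = B k $ 1 $ 2"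
  have a: "A k = map_matrix ((*) a) e12" and b: "B k = map_matrix ((*) b) e12"
    unfolding a_b_def
    using e12_multiple[of "A k"] e12_multiple[of "B k"] A B k tr i D(3)[OF i(1) k]
    by (metis nilp2_tuples_nth)+
  have scale: "map_matrix ((*) x) e12 = (map_matrix ((*) y) e12 :: 'a^2^2) \<longleftrightarrow> x = y" for x y :: 'a
    by (auto simp: mat2_eq_iff)
  have zero: "map_matrix ((*) x) e12 = (0 :: 'a^2^2) \<longleftrightarrow> x = 0" for x :: 'a
    by (auto simp: mat2_eq_iff)
  have ab0: "a = 0 \<longleftrightarrow> b = 0" using D(1)[OF k] a b zero by simp
  have "a = b"
  proof -
    consider "i < k" | "k < i" | "i = k" by linarith
    then show ?thesis
    proof cases
      case 1
      have "a = x \<longleftrightarrow> b = x" if "x \<noteq> 0" "x \<noteq> 1" for x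
        using D(2)[OF i(1) k 1 that] i a b scale by metis
      \<comment> \<open>A value of \<open>a\<close> or \<open>b\<close> outside 0 and 1 is
        recognised by the test at that value; otherwise both lie in {0, 1} and \<open>ab0\<close>
        decides.\<close>
      then show ?thesis using ab0 by metis
    next
      case 2
      have mul: "map_matrix ((*) x) (map_matrix ((*) y) e12) = (e12 :: 'a^2^2) \<longleftrightarrow> x * y = 1" for x y :: 'a
        by (auto simp: mat2_eq_iff)
      \<comment> \<open>Here the \<open>k\<close>-th entry is the first argument of
        \<open>eta\<close>, so the tests see the reciprocals of \<open>a\<close> and
        \<open>b\<close>.\<close>
      have *: "x * a = 1 \<longleftrightarrow> x * b = 1" if "x \<noteq> 0" "x \<noteq> 1" for x
        using D(2)[OF k i(1) 2 that] i a b mul by metis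
      have "inverse a = inverse b" if "a \<noteq> 0" "b \<noteq> 0"
        using *[of "inverse a"] *[of "inverse b"] that
        by (metis inverse_unique inverse_nonzero_iff_nonzero left_inverse inverse_1 inverse_inverse_eq)
      then show ?thesis using ab0 by (metis inverse_inverse_eq)
    next
      case 3
      then show ?thesis using i by (simp add: a_b_def)
    qed
  qed
  then show "A k = B k" using a b by simp
qed

text \<open>Traces against \<open>e12\<close> and \<open>t\<close> times \<open>e21\<close> read off
  the lower left entry and \<open>t\<close> times the upper right entry. Only the diagonal entry
  depends on the characteristic, hence the alternative in \<open>char\<close>.\<close>

lemma normalized_pair_eq:
  fixes A B :: "nat \<Rightarrow> 'a::field^2^2"
  assumes agree: "\<forall>f \<in> H2_char2 m. f A = f B"
    and char: "CHAR('a) = 2 \<or> (\<forall>f \<in> H2 m. f A = f B)"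
    and A: "A \<in> nilp2_tuples m" and B: "B \<in> nilp2_tuples m"
    and ij: "i \<in> {1..m}" "j \<in> {1..m}" "i < j" and t: "t \<noteq> 0"
    and Ai: "A i = e12" "A j = map_matrix ((*) t) e21"
    and Bi: "B i = e12" "B j = map_matrix ((*) t) e21"
  shows "A = B"
proof (rule nilp2_tuples_eqI[OF A B])
  fix k assume k: "k \<in> {1..m}"
  note D = H2_char2_agreeD(3)[OF agree A B]
  note entries = trace_2 mat2_mult_nth
  have c: "A k $ 2 $ 1 = B k $ 2 $ 1"
    using D[OF ij(1) k] by (simp add: Ai Bi entries)
  have b: "A k $ 1 $ 2 = B k $ 1 $ 2"
    using D[OF ij(2) k] t by (simp add: Ai Bi entries)
  have Ak: "A k \<in> nilp2" and Bk: "B k \<in> nilp2"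
    using A B k by (auto intro: nilp2_tuples_nth)
  have a: "A k $ 1 $ 1 = B k $ 1 $ 1"
  proof (cases "k = i \<or> k = j")
    case True
    then show ?thesis using Ai Bi by auto
  next
    case False
    from char show ?thesis
    proof
      assume "CHAR('a) = 2"
      then have two: "(2::'a) = 0" using of_nat_CHAR[where 'a='a] by simp
      define x y where "x = A k $ 1 $ 1" "y = B k $ 1 $ 1"
      have "x * x = y * y"
        using Ak Bk b c by (simp add: nilp2_iff x_y_def) (metis add_right_cancel)
      \<comment> \<open>Both squares equal the same product of off-diagonal entries up to sign, and
        squaring is injective in characteristic 2.\<close>
      then have "(x - y) * (x - y) = 2 * (y * (y - x))"
        by (simp add: algebra_simps)
      then show ?thesis using two by (simp add: x_y_def)
    next
      assume agree3: "\<forall>f \<in> H2 m. f A = f B"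
      note D3 = H2_agreeD[OF agree3 A B]
      \<comment> \<open>The indices of a triple trace increase, so the position of \<open>k\<close>
        fixes the order of the factors. In the outer cases the trace is \<open>t\<close> times the
        upper diagonal entry; in the middle case it is \<open>t\<close> times the lower one, its
        negative by nilpotence.\<close>
      consider "k < i" | "i < k" "k < j" | "j < k" using False by linarith
      then show ?thesis
      proof cases
        case 1
        then show ?thesis using D3[OF k ij(1,2) 1 ij(3)] t by (simp add: Ai Bi entries)
      next
        case 2
        then show ?thesis using D3[OF ij(1) k ij(2) 2] t Ak Bk
          by (simp add: Ai Bi entries nilp2_iff)
      next
        case 3
        then show ?thesis using D3[OF ij(1,2) k ij(3) 3] t by (simp add: Ai Bi entries)
      qed
    qed
  qed
  show "A k = B k" using a b c Ak Bk by (simp add: mat2_eq_iff nilp2_iff)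
qed

lemma invariants_agree:
  fixes A B :: "nat \<Rightarrow> 'a::{field, finite}^2^2"
  assumes agree: "\<forall>f \<in> S. f A = f B"
    and S: "(S = H2_char2 m \<and> CHAR('a) = 2) \<or> S = H2 m"
    and A: "A \<in> nilp2_tuples m" and B: "B \<in> nilp2_tuples m"
    and f: "f \<in> invariant_functions m"
  shows "f A = f B"
proof -
  have sub: "H2_char2 m \<subseteq> S" and inv: "S \<subseteq> invariant_functions m"
    using S H2_subset_invariant_functions[of m] H2_char2_subset_H2[of m] by blast+
  have agree_conj: "\<forall>f \<in> S. f (conj_tuple m g A) = f (conj_tuple m h B)"
    if "invertible g" "invertible h" for g h
    using agree inv invariant_conj_tuple[OF _ that(1) A] invariant_conj_tuple[OF _ that(2) B]
    by (metis subsetD)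
  \<comment> \<open>It suffices to move \<open>A\<close> and \<open>B\<close>, each by its own
    matrix, to a common tuple; by \<open>agree_conj\<close> the functions in \<open>S\<close> still
    agree after such moves.\<close>
  have reduce: ?thesis if "invertible g" "invertible h" "conj_tuple m g A = conj_tuple m h B" for g h
    using invariant_conj_tuple[OF f that(1) A] invariant_conj_tuple[OF f that(2) B] that by simp
  note D = H2_char2_agreeD[OF _ A B]
  have agree2: "\<forall>f \<in> H2_char2 m. f A = f B" using agree sub by blast
  consider i j where "i \<in> {1..m}" "j \<in> {1..m}" "i < j" "trace (A i ** A j) \<noteq> 0"
    | i where "i \<in> {1..m}" "A i \<noteq> 0" "\<forall>j\<in>{1..m}. trace (A i ** A j) = 0"
    | "\<forall>i\<in>{1..m}. A i = 0"
  proof (cases "\<exists>i\<in>{1..m}. \<exists>j\<in>{1..m}. trace (A i ** A j) \<noteq> 0")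
    case True
    then obtain i j where ij: "i \<in> {1..m}" "j \<in> {1..m}" "trace (A i ** A j) \<noteq> 0" by blast
    \<comment> \<open>A nonzero trace can only come from two different indices, and its symmetry
      allows them to be put in increasing order.\<close>
    have "A i ** A i = 0"
      using ij A nilp2_iff_square_zero nilp2_tuples_nth by blast
    then have "i \<noteq> j" using ij by (auto simp: trace_def)
    then consider "i < j" | "j < i" by linarith
    then show thesis
      using that(1)[OF ij(1,2)] that(1)[OF ij(2,1)] ij(3) trace_mul_sym[of "A i" "A j"]
      by cases simp_all
  qed (use that(2,3) in blast)
  then show ?thesis
  proof cases
    case (1 i j)
    define t where "t = trace (A i ** A j)"
    have tB: "t = trace (B i ** B j)" using D(3)[OF agree2] 1 by (simp add: t_def)
    obtain g where g: "invertible g" "conj_mat g (A i) = e12" "conj_mat g (A j) = map_matrix ((*) t) e21"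
      using exists_conj_e12_e21[of "A i" "A j"] 1 A nilp2_tuples_nth unfolding t_def by blast
    obtain h where h: "invertible h" "conj_mat h (B i) = e12" "conj_mat h (B j) = map_matrix ((*) t) e21"
      using exists_conj_e12_e21[of "B i" "B j"] 1 B nilp2_tuples_nth tB unfolding t_def by metis
    have "conj_tuple m g A = conj_tuple m h B"
    proof (rule normalized_pair_eq[where i = i and j = j and t = t])
      show "\<forall>f\<in>H2_char2 m. f (conj_tuple m g A) = f (conj_tuple m h B)"
        and "CHAR('a) = 2 \<or> (\<forall>f\<in>H2 m. f (conj_tuple m g A) = f (conj_tuple m h B))"
        using agree_conj[OF g(1) h(1)] sub S by blast+
      show "t \<noteq> 0" using 1 by (simp add: t_def)
    qed (use 1 g h A B in \<open>simp_all only: conj_tuple_nth conj_tuple_nilp2_tuples\<close>)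
    then show ?thesis using reduce g h by blast
  next
    case (2 i)
    then have "B i \<noteq> 0" using D(1)[OF agree2] by blast
    obtain g where g: "invertible g" "conj_mat g (A i) = e12"
      using exists_conj_e12[of "A i"] 2 A nilp2_tuples_nth by blast
    obtain h where h: "invertible h" "conj_mat h (B i) = e12"
      using exists_conj_e12[of "B i"] \<open>B i \<noteq> 0\<close> 2 B nilp2_tuples_nth by blast
    have "conj_tuple m g A = conj_tuple m h B"
    proof (rule multiples_of_e12_eq[where i = i])
      show "\<forall>f\<in>H2_char2 m. f (conj_tuple m g A) = f (conj_tuple m h B)"
        using agree_conj[OF g(1) h(1)] sub by blast
      show "\<forall>j\<in>{1..m}. trace (conj_tuple m g A i ** conj_tuple m g A j) = 0"
        using 2 g(1) by (simp add: conj_tuple_nth conj_mat_mult trace_conj_mat)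
    qed (use 2 g h A B in \<open>simp_all add: conj_tuple_nth conj_tuple_nilp2_tuples\<close>)
    then show ?thesis using reduce g h by blast
  next
    case 3
    then have "A = B" using D(1)[OF agree2] by (intro nilp2_tuples_eqI[OF A B]) auto
    then show ?thesis by simp
  qed
qed

lemma separating_H2:
  fixes S :: "((nat \<Rightarrow> 'a::{field, finite}^2^2) \<Rightarrow> 'a) set"
  assumes "(S = H2_char2 m \<and> CHAR('a) = 2) \<or> S = H2 m"
  shows "separating m S"
proof -
  have "S \<subseteq> invariant_functions m"
    using assms H2_subset_invariant_functions[of m] H2_char2_subset_H2[of m] by blast
  then show ?thesis
    using invariants_agree[OF _ assms] unfolding separating_def separates_def by metis
qed

section \<open>Minimality\<close>

text \<open>Each \<open>f\<close> in \<open>S\<close> needs a pair that it alone distinguishes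
  within \<open>S\<close>. Since \<open>f\<close> is invariant, the pair has to be separated, which
  a subset of \<open>S\<close> omitting \<open>f\<close> cannot do.\<close>

lemma minimal_separatingI:
  assumes S: "separating m S"
    and wit: "\<And>f. f \<in> S \<Longrightarrow> \<exists>A\<in>nilp2_tuples m. \<exists>B\<in>nilp2_tuples m. f A \<noteq> f B \<and> (\<forall>h\<in>S - {f}. h A = h B)"
  shows "minimal_separating m S"
  unfolding minimal_separating_def
proof (intro conjI S allI impI notI)
  fix T assume T: "T \<subset> S" "separating m T"
  then obtain f where f: "f \<in> S" "f \<notin> T" by blast
  from wit[OF f(1)] obtain A B where AB: "A \<in> nilp2_tuples m" "B \<in> nilp2_tuples m" "f A \<noteq> f B"
    "\<forall>h\<in>S - {f}. h A = h B" by blast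
  have "separates (invariant_functions m) A B"
    using f(1) S AB(3) by (auto simp: separating_def separates_def)
  then have "separates T A B" using T(2) AB by (auto simp: separating_def)
  with AB(4) f T(1) show False by (auto simp: separates_def)
qed

lemma fun_at:
  fixes P :: "nat \<Rightarrow> 'a::field^2^2"
  assumes "\<And>l. P l \<in> nilp2"
  shows "1 \<le> i \<Longrightarrow> i < j \<Longrightarrow> j \<le> m \<Longrightarrow> tr2_fun m i j (restrict P {1..m}) = trace (P i ** P j)"
    and "1 \<le> i \<Longrightarrow> i < j \<Longrightarrow> j < k \<Longrightarrow> k \<le> m \<Longrightarrow>
      tr3_fun m i j k (restrict P {1..m}) = trace (P i ** P j ** P k)"
    and "1 \<le> i \<Longrightarrow> i \<le> m \<Longrightarrow> zeta_fun m i (restrict P {1..m}) = zeta (P i)"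
    and "1 \<le> i \<Longrightarrow> i < j \<Longrightarrow> j \<le> m \<Longrightarrow> eta_fun m \<alpha> i j (restrict P {1..m}) = eta \<alpha> (P i) (P j)"
  using restrict_nilp2_tuples[of P m] assms by (simp_all add: fun_defs)

lemma H2_cases:
  assumes "f \<in> H2 m"
  obtains (tr2) i j where "f = tr2_fun m i j" "1 \<le> i" "i < j" "j \<le> m"
  | (zeta) i where "f = zeta_fun m i" "1 \<le> i" "i \<le> m"
  | (eta) i j \<alpha> where "f = eta_fun m \<alpha> i j" "1 \<le> i" "i < j" "j \<le> m" "\<alpha> \<noteq> 0" "\<alpha> \<noteq> 1"
  | (tr3) i j k where "f = tr3_fun m i j k" "1 \<le> i" "i < j" "j < k" "k \<le> m"
  using assms unfolding H2_def H2_char2_def by (elim UnE CollectE exE conjE DiffE) simp_all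

text \<open>Turns agreement of all generators except \<open>f\<close> into conditions on the
  matrices \<open>P l\<close> and \<open>Q l\<close>. The premises of the form
  \<open>f \<noteq> ...\<close> exempt the one generator that is meant to differ.\<close>

lemma H2_agreeI:
  fixes P Q :: "nat \<Rightarrow> 'a::field^2^2"
  assumes P: "\<And>l. P l \<in> nilp2" and Q: "\<And>l. Q l \<in> nilp2"
    and "\<And>i j. i < j \<Longrightarrow> f \<noteq> tr2_fun m i j \<Longrightarrow> trace (P i ** P j) = trace (Q i ** Q j)"
    and "\<And>i. f \<noteq> zeta_fun m i \<Longrightarrow> P i = 0 \<longleftrightarrow> Q i = 0"
    and "\<And>i j \<alpha>. i < j \<Longrightarrow> \<alpha> \<noteq> 0 \<Longrightarrow> \<alpha> \<noteq> 1 \<Longrightarrow> f \<noteq> eta_fun m \<alpha> i j \<Longrightarrow>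
      map_matrix ((*) \<alpha>) (P i) = P j \<longleftrightarrow> map_matrix ((*) \<alpha>) (Q i) = Q j"
    and "\<And>i j k. i < j \<Longrightarrow> j < k \<Longrightarrow> f \<noteq> tr3_fun m i j k \<Longrightarrow>
      trace (P i ** P j ** P k) = trace (Q i ** Q j ** Q k)"
    and h: "h \<in> H2 m - {f}"
  shows "h (restrict P {1..m}) = h (restrict Q {1..m})"
proof -
  have "h \<in> H2 m" "f \<noteq> h" using h by auto
  then show ?thesis
  proof (cases rule: H2_cases)
    case (tr2 i j)
    then show ?thesis using assms(3)[of i j] \<open>f \<noteq> h\<close> by (simp del: One_nat_def add: fun_at[OF P] fun_at[OF Q])
  next
    case (zeta i)
    then show ?thesis using assms(4)[of i] \<open>f \<noteq> h\<close> by (simp del: One_nat_def add: fun_at[OF P] fun_at[OF Q] zeta_def)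
  next
    case (eta i j \<alpha>)
    then show ?thesis using assms(5)[of i j \<alpha>] \<open>f \<noteq> h\<close>
      by (simp del: One_nat_def add: fun_at[OF P] fun_at[OF Q] eta_def)
  next
    case (tr3 i j k)
    then show ?thesis using assms(6)[of i j k] \<open>f \<noteq> h\<close> by (simp del: One_nat_def add: fun_at[OF P] fun_at[OF Q])
  qed
qed

text \<open>The pairs agree on all of \<open>H2 m\<close> except \<open>f\<close>, hence also on the
  smaller set used in characteristic 2, so one construction serves both cases.\<close>

lemma H2_witness:
  fixes f :: "(nat \<Rightarrow> 'a::field^2^2) \<Rightarrow> 'a"
  assumes f: "f \<in> H2 m" and char: "f \<in> H2_char2 m \<or> (2 :: 'a) \<noteq> 0"
  shows "\<exists>A\<in>nilp2_tuples m. \<exists>B\<in>nilp2_tuples m. f A \<noteq> f B \<and> (\<forall>h\<in>H2 m - {f}. h A = h B)"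
proof -
  have wit: ?thesis
    if P: "\<And>l. P l \<in> nilp2" and Q: "\<And>l. Q l \<in> nilp2"
      and "f (restrict P {1..m}) \<noteq> f (restrict Q {1..m})"
      and "\<And>h. h \<in> H2 m - {f} \<Longrightarrow> h (restrict P {1..m}) = h (restrict Q {1..m})" for P Q
    using restrict_nilp2_tuples[of P m] restrict_nilp2_tuples[of Q m] that by blast
  note [simp] = zero_nilp2 e12_nilp2 e21_nilp2 e12_nonzero map_matrix_zero
  note entries = trace_2 mat2_mult_nth mat2_eq_iff
  from f show ?thesis
  proof (cases rule: H2_cases)
    case (tr2 i j)
    \<comment> \<open>The trace is 1 on \<open>P\<close> and 0 on \<open>Q\<close>. The zero entries
      are the same, triple traces contain a zero factor, and a multiple of \<open>e12\<close> by
      \<alpha> \<noteq> 1 is neither \<open>e21\<close> nor \<open>e12\<close>.\<close>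
    define P Q :: "nat \<Rightarrow> 'a^2^2" where
      "P = (\<lambda>l. if l = i then e12 else if l = j then e21 else 0)"
      and "Q = (\<lambda>l. if l = i \<or> l = j then e12 else 0)"
    have PQ: "P l \<in> nilp2" "Q l \<in> nilp2" for l by (auto simp: P_def Q_def)
    show ?thesis
    proof (rule wit[OF PQ])
      show "f (restrict P {1..m}) \<noteq> f (restrict Q {1..m})"
        using tr2 by (simp del: One_nat_def add: fun_at[OF PQ(1)] fun_at[OF PQ(2)]) (simp add: P_def Q_def entries)
    next
      fix h assume h: "h \<in> H2 m - {f}"
      show "h (restrict P {1..m}) = h (restrict Q {1..m})"
        by (rule H2_agreeI[OF PQ _ _ _ _ h])
          (use tr2 in \<open>auto simp: P_def Q_def entries split: if_splits\<close>)
    qed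
  next
    case (zeta i)
    \<comment> \<open>A zero at another index \<open>j\<close> would let \<open>\<eta>\<^sub>\<alpha>(Y\<^sub>i, Y\<^sub>j)\<close> see whether the \<open>i\<close>-th entry vanishes.\<close>
    define P Q :: "nat \<Rightarrow> 'a^2^2" where "P = (\<lambda>l. e12)" and "Q = (\<lambda>l. if l = i then 0 else e12)"
    have PQ: "P l \<in> nilp2" "Q l \<in> nilp2" for l by (auto simp: P_def Q_def)
    show ?thesis
    proof (rule wit[OF PQ])
      show "f (restrict P {1..m}) \<noteq> f (restrict Q {1..m})"
        using zeta by (simp del: One_nat_def add: fun_at[OF PQ(1)] fun_at[OF PQ(2)]) (simp add: P_def Q_def zeta_def)
    next
      fix h assume h: "h \<in> H2 m - {f}"
      show "h (restrict P {1..m}) = h (restrict Q {1..m})"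
        by (rule H2_agreeI[OF PQ _ _ _ _ h])
          (use zeta in \<open>auto simp: P_def Q_def entries split: if_splits\<close>)
    qed
  next
    case (eta i j \<alpha>)
    \<comment> \<open>All traces vanish on both tuples and the zero entries are the same. The ratio
      of the two nonzero entries is \<alpha> in \<open>P\<close> and 1 in \<open>Q\<close>, and the
      value 1 is tested by no generator.\<close>
    define P Q :: "nat \<Rightarrow> 'a^2^2" where
      "P = (\<lambda>l. if l = i then e12 else if l = j then map_matrix ((*) \<alpha>) e12 else 0)"
      and "Q = (\<lambda>l. if l = i \<or> l = j then e12 else 0)"
    have PQ: "P l \<in> nilp2" "Q l \<in> nilp2" for l by (auto simp: P_def Q_def map_matrix_nilp2)
    show ?thesis
    proof (rule wit[OF PQ])
      show "f (restrict P {1..m}) \<noteq> f (restrict Q {1..m})"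
        using eta by (simp del: One_nat_def add: fun_at[OF PQ(1)] fun_at[OF PQ(2)]) (simp add: P_def Q_def eta_def entries)
    next
      fix h assume h: "h \<in> H2 m - {f}"
      show "h (restrict P {1..m}) = h (restrict Q {1..m})"
        by (rule H2_agreeI[OF PQ _ _ _ _ h])
          (use eta in \<open>auto simp: P_def Q_def entries split: if_splits\<close>)
    qed
  next
    case (tr3 i j k)
    then have two: "(2 :: 'a) \<noteq> 0"
      using char H2_disjoint[of m, where 'a='a] by blast
    \<comment> \<open>For \<open>s\<close> equal to 1 or -1 this is nilpotent with off-diagonal
      entries independent of \<open>s\<close>, so traces against \<open>e12\<close> and
      \<open>e21\<close> agree, while the triple trace with both is \<open>s\<close>.\<close>
    define M :: "'a \<Rightarrow> 'a^2^2" where "M s = vector [vector [s, 1], vector [- 1, - s]]" for s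
    have M: "M s \<in> nilp2" if "s * s = 1" for s
      using that by (simp add: M_def nilp2_iff)
    define P where
      "P s = (\<lambda>l. if l = i then e12 else if l = j then e21 else if l = k then M s else 0)" for s :: 'a
    have PQ: "P 1 l \<in> nilp2" "P (- 1) l \<in> nilp2" for l by (auto simp: P_def M)
    show ?thesis
    proof (rule wit[OF PQ])
      have "(1 :: 'a) \<noteq> - 1"
        using two by (metis add.right_inverse one_add_one)
      then show "f (restrict (P 1) {1..m}) \<noteq> f (restrict (P (- 1)) {1..m})"
        using tr3 by (simp del: One_nat_def add: fun_at[OF PQ(1)] fun_at[OF PQ(2)]) (simp add: P_def entries M_def)
    next
      fix h assume h: "h \<in> H2 m - {f}"
      show "h (restrict (P 1) {1..m}) = h (restrict (P (- 1)) {1..m})"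
        by (rule H2_agreeI[OF PQ _ _ _ _ h])
          (use tr3 in \<open>auto simp: P_def M_def entries split: if_splits\<close>)
    qed
  qed
qed

theorem theorem4p5:
  fixes m :: nat
  assumes "m > 0"
  shows "(CHAR('a::{field, finite}) = 2 \<longrightarrow>
            minimal_separating m (H2_char2 m :: ((nat \<Rightarrow> 'a^2^2) \<Rightarrow> 'a) set)) \<and>
         (CHAR('a) > 2 \<longrightarrow>
            minimal_separating m (H2 m :: ((nat \<Rightarrow> 'a^2^2) \<Rightarrow> 'a) set))"
proof (intro conjI impI)
  assume "CHAR('a) = 2"
  then show "minimal_separating m (H2_char2 m :: ((nat \<Rightarrow> 'a^2^2) \<Rightarrow> 'a) set)"
    \<comment> \<open>The witnesses agree on \<open>H2 m - {f}\<close>, which contains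
      \<open>H2_char2 m - {f}\<close>.\<close>
    by (intro minimal_separatingI separating_H2) (use H2_witness H2_char2_subset_H2 in \<open>blast+\<close>)
next
  assume "CHAR('a) > 2"
  then have "\<not> CHAR('a) dvd 2" by (auto dest: dvd_imp_le)
  then have "(2 :: 'a) \<noteq> 0"
    using of_nat_eq_0_iff_char_dvd[of 2, where 'a='a] by simp
  then show "minimal_separating m (H2 m :: ((nat \<Rightarrow> 'a^2^2) \<Rightarrow> 'a) set)"
    by (intro minimal_separatingI separating_H2 H2_witness) simp_all
qed

end
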